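(* Let $K\in\mathcal{K}^n$ and let $\mu=\mu(K)$ be its covering radius. Then $$\mathrm{G}(K)\leq\mathrm{vol}(K)\,(1+\mu)^n.$$ If $\mu\leq 1$, i.e., $K+\mathbb{Z}^n=\mathbb{R}^n$, then also $$\mathrm{G}(\mathrm{int}\,K)\geq\mathrm{vol}(K)\,(1-\mu)^n.$$ Both inequalities are tight, i.e., for each of them there are bodies $K$ for which equality holds.
   Context: $\mathcal{K}^n$ is the class of all compact convex sets in $\mathbb{R}^n$ with non-empty interior. For $A\subseteq\mathbb{R}^n$, $\mathrm{G}(A)=|A\cap\mathbb{Z}^n|$ is the number of integer points in $A$; $\mathrm{vol}$ is the $n$-dimensional volume and $\mathrm{int}$ denotes the interior. The covering radius $\mu(K)$ is the smallest number $\mu>0$ such that $\mu K+\mathbb{Z}^n=\mathbb{R}^n$. *)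

theory Defs
  imports "HOL-Analysis.Analysis"
begin

definition convex_bodies :: "(real ^ 'n) set set" where
  "convex_bodies = {K. compact K \<and> convex K \<and> interior K \<noteq> {}}"

definition integer_points :: "(real ^ 'n) set" where
  "integer_points = {x. \<forall>i. x $ i \<in> \<int>}"

text \<open>Only applied to bounded sets, where the intersection is finite; \<open>card\<close> is \<open>0\<close> on
  infinite sets.\<close>

definition lattice_count :: "(real ^ 'n) set \<Rightarrow> nat" where
  "lattice_count A = card (A \<inter> integer_points)"

text \<open>The sum of two sets is the Minkowski sum. \<open>LEAST\<close> is meaningful only if the minimum
  exists; lemma \<open>covering_radius_least\<close> below shows that it does for every convex body.\<close>

definition covering_radius :: "(real ^ 'n) set \<Rightarrow> real" where
  "covering_radius K = (LEAST \<mu>. 0 < \<mu> \<and> (*\<^sub>R) \<mu> ` K + integer_points = UNIV)"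

lemma finite_integer_points_bounded:
  fixes A :: "(real ^ 'n) set"
  assumes "bounded A"
  shows "finite (A \<inter> integer_points)"
proof -
  obtain B where B: "\<And>x. x \<in> A \<Longrightarrow> norm x \<le> B"
    using assms by (auto simp: bounded_iff)
  define F where "F = {r :: real. r \<in> \<int> \<and> \<bar>r\<bar> \<le> B}"
  have "F \<subseteq> of_int ` {- \<lceil>B\<rceil>..\<lceil>B\<rceil>}"
  proof
    fix r assume "r \<in> F"
    then obtain i where "r = of_int i" "\<bar>of_int i :: real\<bar> \<le> B"
      unfolding F_def by (auto elim: Ints_cases)
    moreover from this have "- \<lceil>B\<rceil> \<le> i" "i \<le> \<lceil>B\<rceil>" by linarith+
    ultimately show "r \<in> of_int ` {- \<lceil>B\<rceil>..\<lceil>B\<rceil>}" by simp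
  qed
  then have "finite F" by (rule finite_subset) auto
  then have "finite {f. \<forall>i :: 'n. f i \<in> F}"
    using finite_PiE[of UNIV "\<lambda>_ :: 'n. F"] by (simp add: PiE_UNIV_domain Pi_def)
  then have "finite (vec_lambda ` {f. \<forall>i :: 'n. f i \<in> F})" by blast
  moreover have "A \<inter> integer_points \<subseteq> vec_lambda ` {f. \<forall>i :: 'n. f i \<in> F}"
  proof
    fix x assume x: "x \<in> A \<inter> integer_points"
    have "\<bar>x $ i\<bar> \<le> B" for i
      using B[of x] x component_le_norm_cart[of x i] by simp
    then have "($) x \<in> {f. \<forall>i :: 'n. f i \<in> F}"
      using x by (simp add: F_def integer_points_def)
    moreover have "x = vec_lambda (($) x)" by (simp add: vec_eq_iff)
    ultimately show "x \<in> vec_lambda ` {f. \<forall>i :: 'n. f i \<in> F}" by (intro image_eqI[of x vec_lambda "($) x"])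
  qed
  ultimately show ?thesis by (rule rev_finite_subset)
qed

lemma integer_approx:
  fixes x :: "real ^ 'n"
  obtains z where "z \<in> integer_points" "norm (x - z) \<le> real CARD('n)"
proof
  let ?z = "(\<chi> i. of_int \<lfloor>x $ i\<rfloor>) :: real ^ 'n"
  show "?z \<in> integer_points" by (simp add: integer_points_def)
  have "norm (x - ?z) \<le> (\<Sum>i\<in>UNIV. \<bar>(x - ?z) $ i\<bar>)" by (rule norm_le_l1_cart)
  also have "\<dots> \<le> (\<Sum>i\<in>(UNIV::'n set). 1)"
    by (rule sum_mono) (simp, linarith)
  finally show "norm (x - ?z) \<le> real CARD('n)" by simp
qed

lemma ex_covering:
  fixes K :: "(real ^ 'n) set"
  assumes "K \<in> convex_bodies"
  shows "\<exists>\<mu>>0. (*\<^sub>R) \<mu> ` K + integer_points = UNIV"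
proof -
  obtain c e where e: "e > 0" "cball c e \<subseteq> K"
    using assms by (auto simp: convex_bodies_def mem_interior_cball ex_in_conv[symmetric])
  define \<mu> where "\<mu> = real CARD('n) / e"
  have pos: "\<mu> > 0" using e by (simp add: \<mu>_def)
  have "y \<in> (*\<^sub>R) \<mu> ` K + integer_points" for y
  proof -
    obtain z where z: "z \<in> integer_points" "norm ((y - \<mu> *\<^sub>R c) - z) \<le> real CARD('n)"
      by (rule integer_approx)
    define k where "k = c + (1 / \<mu>) *\<^sub>R ((y - \<mu> *\<^sub>R c) - z)"
    have "norm (k - c) = norm ((y - \<mu> *\<^sub>R c) - z) / \<mu>" using pos by (simp add: k_def)
    also have "\<dots> \<le> real CARD('n) / \<mu>" using z pos by (simp add: divide_right_mono)
    also have "\<dots> = e" using e by (simp add: \<mu>_def)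
    finally have "k \<in> K" using e by (auto simp: dist_norm norm_minus_commute)
    moreover have "y = \<mu> *\<^sub>R k + z" using pos by (simp add: k_def algebra_simps)
    ultimately show ?thesis using z by auto
  qed
  then show ?thesis using pos by blast
qed

lemma covering_limit:
  fixes K :: "(real ^ 'n) set"
  assumes "compact K" and m: "m \<longlonglongrightarrow> \<mu>"
    and cov: "\<And>j::nat. (*\<^sub>R) (m j) ` K + integer_points = UNIV"
  shows "(*\<^sub>R) \<mu> ` K + integer_points = UNIV"
proof -
  have "y \<in> (*\<^sub>R) \<mu> ` K + integer_points" for y
  proof -
    have "\<exists>k z. k \<in> K \<and> z \<in> integer_points \<and> y = m j *\<^sub>R k + z" for j
      using cov[of j] UNIV_I[of y] by (metis (no_types, lifting) imageE set_plus_elim)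
    then obtain k z where kz: "\<And>j. k j \<in> K" "\<And>j. z j \<in> integer_points"
      "\<And>j. y = m j *\<^sub>R k j + z j" by metis
    obtain C where C: "\<And>x. x \<in> K \<Longrightarrow> norm x \<le> C"
      using compact_imp_bounded[OF assms(1)] by (auto simp: bounded_iff)
    obtain M where M: "\<And>j. \<bar>m j\<bar> \<le> M"
      using convergent_imp_Bseq[of m] m by (auto simp: convergent_def Bseq_def)
    have "norm (z j) \<le> norm y + M * C" for j
    proof -
      have "z j = y - m j *\<^sub>R k j" using kz(3)[of j] by (simp add: algebra_simps)
      then have "norm (z j) \<le> norm y + \<bar>m j\<bar> * norm (k j)"
        using norm_triangle_ineq4[of y "m j *\<^sub>R k j"] by simp
      moreover have "\<bar>m j\<bar> * norm (k j) \<le> M * C"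
        using M[of j] C[OF kz(1)[of j]] by (intro mult_mono) auto
      ultimately show ?thesis by linarith
    qed
    then have "z j \<in> cball 0 (norm y + M * C) \<inter> integer_points" for j
      using kz(2) by simp
    then have "range z \<subseteq> cball 0 (norm y + M * C) \<inter> integer_points" by blast
    then have fin: "finite (range z)"
      using finite_integer_points_bounded[OF bounded_cball] finite_subset by blast
    obtain w r where r: "strict_mono r" "w \<in> range z" "(z \<circ> r) \<longlonglongrightarrow> w"
      using finite_imp_compact[OF fin] unfolding compact_def by (metis rangeI)
    obtain x s where s: "strict_mono s" "x \<in> K" "((k \<circ> r) \<circ> s) \<longlonglongrightarrow> x"
      using assms(1) kz(1) unfolding compact_def by (metis comp_apply)
    have "(\<lambda>j. m (r (s j)) *\<^sub>R k (r (s j)) + z (r (s j))) \<longlonglongrightarrow> \<mu> *\<^sub>R x + w"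
      using LIMSEQ_subseq_LIMSEQ[OF LIMSEQ_subseq_LIMSEQ[OF m r(1)] s(1)]
        s(3) LIMSEQ_subseq_LIMSEQ[OF r(3) s(1)]
      by (intro tendsto_intros) (auto simp: o_def)
    moreover have "(\<lambda>j. m (r (s j)) *\<^sub>R k (r (s j)) + z (r (s j))) = (\<lambda>_. y)"
      using kz(3) by (metis (no_types))
    ultimately have "y = \<mu> *\<^sub>R x + w" using LIMSEQ_unique tendsto_const by metis
    moreover have "w \<in> integer_points" using r(2) kz(2) by auto
    ultimately show ?thesis using s(2) by auto
  qed
  then show ?thesis by blast
qed

lemma covering_radius_least:
  fixes K :: "(real ^ 'n) set"
  assumes K: "K \<in> convex_bodies"
  shows "0 < covering_radius K"
    and "(*\<^sub>R) (covering_radius K) ` K + integer_points = UNIV"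
    and "\<And>\<mu>. 0 < \<mu> \<Longrightarrow> (*\<^sub>R) \<mu> ` K + integer_points = UNIV \<Longrightarrow> covering_radius K \<le> \<mu>"
proof -
  define S where "S = {\<mu>. 0 < \<mu> \<and> (*\<^sub>R) \<mu> ` K + integer_points = UNIV}"
  have ne: "S \<noteq> {}" using ex_covering[OF K] by (auto simp: S_def)
  have bdd: "bdd_below S" unfolding S_def by (rule bdd_belowI[of _ 0]) auto
  have "Inf S \<in> closure S" using closure_contains_Inf[OF ne bdd] .
  then obtain m where m: "\<And>j. m j \<in> S" "m \<longlonglongrightarrow> Inf S"
    unfolding closure_sequential by blast
  have cov: "(*\<^sub>R) (Inf S) ` K + integer_points = UNIV"
  proof (rule covering_limit[OF _ m(2)])
    show "compact K" using K by (simp add: convex_bodies_def)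
    show "(*\<^sub>R) (m j) ` K + integer_points = UNIV" for j
      using m(1)[of j] by (simp add: S_def)
  qed
  have "Inf S \<noteq> 0"
  proof
    assume "Inf S = 0"
    then have "vec (1/2) \<in> (*\<^sub>R) 0 ` K + (integer_points :: (real ^ 'n) set)"
      using cov by simp
    then obtain k z where "z \<in> (integer_points :: (real ^ 'n) set)" "vec (1/2) = 0 *\<^sub>R k + z"
      by (elim set_plus_elim imageE) blast
    then have "(vec (1/2) :: real ^ 'n) \<in> integer_points" by simp
    then have "(1/2 :: real) \<in> \<int>" by (simp add: integer_points_def)
    then obtain i where "1/2 = real_of_int i" by (rule Ints_cases)
    then have "of_int (2 * i) = (1 :: real)" by simp
    then have "2 * i = 1" by (simp only: of_int_eq_1_iff)
    then show False by presburger
  qed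
  moreover have "0 \<le> Inf S" using ne by (intro cInf_greatest) (auto simp: S_def)
  ultimately have mem: "0 < Inf S \<and> (*\<^sub>R) (Inf S) ` K + integer_points = UNIV"
    using cov by linarith
  have low: "Inf S \<le> \<mu>" if "0 < \<mu> \<and> (*\<^sub>R) \<mu> ` K + integer_points = UNIV" for \<mu>
    using that bdd by (intro cInf_lower) (auto simp: S_def)
  have "covering_radius K = Inf S"
    unfolding covering_radius_def using mem low by (rule Least_equality)
  then show "0 < covering_radius K"
    and "(*\<^sub>R) (covering_radius K) ` K + integer_points = UNIV"
    and "\<And>\<mu>. 0 < \<mu> \<Longrightarrow> (*\<^sub>R) \<mu> ` K + integer_points = UNIV \<Longrightarrow> covering_radius K \<le> \<mu>"
    using mem low by auto
qed

end

theory Submission imports Defs begin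

text \<open>Cutting the half-open unit cube along the integer translates of \<open>\<mu>K\<close> and reassembling the
  pieces yields a measurable fundamental domain \<open>P \<subseteq> \<mu>K\<close> of the integer lattice, of volume 1.
  The translates of \<open>P\<close> by the lattice points of \<open>K\<close> are disjoint and lie in
  \<open>K + \<mu>K = (1 + \<mu>)K\<close>, which gives the upper bound. For the lower bound take \<open>P \<subseteq> -\<mu>K\<close>: a
  lattice point \<open>s\<close> whose translate \<open>s + P\<close> meets \<open>(1 - \<mu>) int K\<close> lies in
  \<open>(1 - \<mu>) int K + \<mu>K \<subseteq> int K\<close>, so the translates by lattice points of \<open>int K\<close> cover
  \<open>(1 - \<mu>) int K\<close>. The unit cube has \<open>\<mu> = 1\<close> and attains equality in both.\<close>

section \<open>The integer lattice\<close>

lemma integer_points_diff: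
  "x \<in> integer_points \<Longrightarrow> y \<in> integer_points \<Longrightarrow> x - y \<in> integer_points"
  and integer_points_minus:
  "x \<in> integer_points \<Longrightarrow> - x \<in> integer_points"
  by (auto simp: integer_points_def)

lemma countable_integer_points: "countable (integer_points :: (real ^ 'n) set)"
proof -
  have "(integer_points :: (real ^ 'n) set) = (\<Union>n::nat. cball 0 (real n) \<inter> integer_points)"
    by (auto simp: real_arch_simple)
  moreover have "countable (\<Union>n::nat. cball 0 (real n) \<inter> (integer_points :: (real ^ 'n) set))"
    by (rule countable_UN) (auto intro: countable_finite finite_integer_points_bounded)
  ultimately show ?thesis by simp
qed

lemma covering_decomposition:
  fixes K :: "(real ^ 'n) set"
  assumes "(*\<^sub>R) m ` K + integer_points = UNIV"
  obtains k z where "k \<in> K" "z \<in> integer_points" "y = m *\<^sub>R k + z"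
proof -
  have "y \<in> (*\<^sub>R) m ` K + integer_points" using assms by simp
  then show thesis using that by (auto elim!: set_plus_elim)
qed

section \<open>The unit cube and its half-open version\<close>

lemma measure_unit_cube: "measure lebesgue (cbox 0 1 :: (real ^ 'n) set) = 1"
  by (simp add: content_cbox_if_cart interval_eq_empty_cart)

text \<open>Half-open, so that every class modulo the lattice has exactly one representative; the
  closed cube would repeat classes on opposite faces.\<close>

definition half_open_cube :: "(real ^ 'n) set" where
  "half_open_cube = {x. \<forall>i. 0 \<le> x $ i \<and> x $ i < 1}"

text \<open>The half-open and the closed cube differ only in frontier points, and the frontier of a
  convex set is negligible.\<close>

lemma half_open_cube_lmeasurable: "(half_open_cube :: (real ^ 'n) set) \<in> lmeasurable"
  and measure_half_open_cube: "measure lebesgue (half_open_cube :: (real ^ 'n) set) = 1"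
proof -
  let ?Q = "half_open_cube :: (real ^ 'n) set" and ?I = "cbox 0 1 :: (real ^ 'n) set"
  have "negligible (?I - ?Q)"
  proof (rule negligible_subset[OF negligible_convex_frontier[of ?I]])
    show "?I - ?Q \<subseteq> frontier ?I"
      by (force simp: frontier_cbox half_open_cube_def mem_box_cart)
  qed simp
  moreover have "?Q - ?I = {}"
    by (auto simp: half_open_cube_def mem_box_cart less_imp_le)
  ultimately have neg: "negligible (?I - ?Q \<union> (?Q - ?I))" by simp
  show "?Q \<in> lmeasurable"
    using lmeasurable_negligible_symdiff[OF lmeasurable_cbox neg] .
  have "measure lebesgue ?Q = measure lebesgue ?I"
    by (rule measure_negligible_symdiff[OF lmeasurable_cbox neg])
  also have "\<dots> = 1" by (rule measure_unit_cube)
  finally show "measure lebesgue ?Q = 1" .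
qed

lemma half_open_cube_cover:
  fixes y :: "real ^ 'n"
  obtains q z where "q \<in> half_open_cube" "z \<in> integer_points" "y = q + z"
proof
  show "(\<chi> i. frac (y $ i)) \<in> half_open_cube"
    by (simp add: half_open_cube_def frac_lt_1)
  show "(\<chi> i. of_int \<lfloor>y $ i\<rfloor>) \<in> integer_points"
    by (simp add: integer_points_def)
  show "y = (\<chi> i. frac (y $ i)) + (\<chi> i. of_int \<lfloor>y $ i\<rfloor>)"
    by (simp add: vec_eq_iff frac_def)
qed

lemma half_open_cube_inj:
  assumes "p \<in> half_open_cube" "q \<in> half_open_cube" "p - q \<in> integer_points"
  shows "p = q"
proof -
  have "p $ i = q $ i" for i
  proof -
    obtain k where k: "p $ i - q $ i = of_int k"
      using assms(3) by (auto simp: integer_points_def elim: Ints_cases)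
    have "0 \<le> p $ i" "p $ i < 1" "0 \<le> q $ i" "q $ i < 1"
      using assms(1,2) by (auto simp: half_open_cube_def)
    then have "k = 0" using k by linarith
    then show ?thesis using k by simp
  qed
  then show ?thesis by (simp add: vec_eq_iff)
qed

section \<open>Fundamental domains inside covering sets\<close>

text \<open>Each point of the half-open cube is assigned to the first lattice vector in an
  enumeration whose translate of \<open>A\<close> contains it; moving the pieces back into
  \<open>A\<close> preserves volumes and classes modulo the lattice. Stated for a general
  \<open>A\<close> so that it serves both \<open>m K\<close> and \<open>- m K\<close>.\<close>

lemma fundamental_domain_exists:
  fixes A :: "(real ^ 'n) set"
  assumes A: "A \<in> lmeasurable" and cov: "A + integer_points = UNIV"
  obtains P where "P \<subseteq> A" "P \<in> lmeasurable" "measure lebesgue P = 1"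
    "P + integer_points = UNIV"
    "\<forall>p\<in>P. \<forall>q\<in>P. p - q \<in> integer_points \<longrightarrow> p = q"
proof -
  have "(0 :: real ^ 'n) \<in> integer_points" by (simp add: integer_points_def)
  then have ne: "(integer_points :: (real ^ 'n) set) \<noteq> {}" by blast
  define z :: "nat \<Rightarrow> real ^ 'n" where "z = from_nat_into integer_points"
  have range_z: "range z = integer_points"
    unfolding z_def using ne countable_integer_points by (rule range_from_nat_into)
  then have z: "z i \<in> integer_points" for i by blast
  \<comment> \<open>\<open>E i\<close> is the part of the cube covered by \<open>A - z i\<close>;
    \<open>disjointed\<close> then removes what earlier indices already cover.\<close>
  define E where "E i = (\<lambda>x. x - z i) ` A \<inter> half_open_cube" for i
  define D where "D = disjointed E"
  define P where "P = (\<Union>i. (+) (z i) ` D i)"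
  have DE: "D i \<subseteq> E i" for i unfolding D_def by (rule disjointed_subset)
  have DQ: "D i \<subseteq> half_open_cube" for i using DE[of i] by (auto simp: E_def)
  have disj: "disjoint_family D" unfolding D_def by (rule disjoint_family_disjointed)
  have "range E \<subseteq> sets lebesgue"
    using measurable_translation_subtract[OF A] half_open_cube_lmeasurable
    by (auto simp: E_def intro!: sets.Int fmeasurableD)
  then have D_sets: "range D \<subseteq> sets lebesgue"
    unfolding D_def by (rule sets.range_disjointed_sets)
  then have T_sets: "range (\<lambda>i. (+) (z i) ` D i) \<subseteq> sets lebesgue"
    by (auto intro!: lebesgue_sets_translation)
  have UN_D: "(\<Union>i. D i) = half_open_cube"
  proof -
    have "\<exists>i. q \<in> E i" if q: "q \<in> half_open_cube" for q
    proof -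
      obtain a w where aw: "a \<in> A" "w \<in> integer_points" "q = a + w"
        using cov UNIV_I[of q] by (metis set_plus_elim)
      then obtain i where "z i = - w"
        using range_z integer_points_minus by (metis rangeE)
      then have "q = a - z i" using aw by simp
      then have "q \<in> E i" using q aw(1) by (auto simp: E_def)
      then show ?thesis ..
    qed
    then show ?thesis unfolding D_def UN_disjointed_eq by (auto simp: E_def)
  qed
  have PA: "P \<subseteq> A" 
  proof -
    have "z i + d \<in> A" if "d \<in> D i" for i :: nat and d using that DE[of i] by (auto simp: E_def)
    then show ?thesis by (auto simp: P_def)
  qed
  have "P \<in> sets lebesgue" using T_sets unfolding P_def by blast
  then have P_meas: "P \<in> lmeasurable" by (rule fmeasurableI2[OF A PA])
  \<comment> \<open>Congruent points of \<open>P\<close> come from congruent points of the cube,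
    which coincide; disjointness of the \<open>D i\<close> then forces equal indices. This gives
    both the disjointness of the moved pieces and the uniqueness of representatives in
    \<open>P\<close>.\<close>
  have inj: "i = j \<and> d = e"
    if "d \<in> D i" "e \<in> D j" "(z i + d) - (z j + e) \<in> integer_points" for i j d e
  proof -
    have "d - e = ((z i + d) - (z j + e)) - (z i - z j)" by simp
    then have "d - e \<in> integer_points"
      using integer_points_diff[OF that(3) integer_points_diff[OF z z]] by metis
    then have "d = e" using half_open_cube_inj that DQ by blast
    then show ?thesis using that disj by (auto simp: disjoint_family_on_def)
  qed
  have disjT: "disjoint_family (\<lambda>i. (+) (z i) ` D i)"
  proof (clarsimp simp: disjoint_family_on_def)
    fix i j :: nat assume "i \<noteq> j"
    moreover have "i = j" if "d \<in> D i" "e \<in> D j" "z i + d = z j + e" for d e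
      using inj[OF that(1,2)] that(3) by (simp add: integer_points_def)
    ultimately show "(+) (z i) ` D i \<inter> (+) (z j) ` D j = {}" by auto
  qed
  \<comment> \<open>By translation invariance the series for \<open>P\<close> and for the cube agree
    term by term, so their sums agree.\<close>
  have "(\<lambda>i. measure lebesgue ((+) (z i) ` D i)) sums measure lebesgue P"
    unfolding P_def using T_sets disjT P_meas
    by (intro measure_UNION) (auto simp: P_def fmeasurable_def)
  moreover have "(\<lambda>i. measure lebesgue (D i)) sums measure lebesgue (\<Union>i. D i)"
    using half_open_cube_lmeasurable[where 'n = 'n] D_sets disj
    by (intro measure_UNION) (auto simp: UN_D fmeasurable_def)
  ultimately have "measure lebesgue P = 1"
    by (simp add: measure_translation UN_D measure_half_open_cube sums_unique2)
  moreover have "y \<in> P + integer_points" for y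
  proof -
    obtain q w where qw: "q \<in> half_open_cube" "w \<in> integer_points" "y = q + w"
      by (rule half_open_cube_cover)
    then obtain i where "q \<in> D i" using UN_D by blast
    then have "z i + q \<in> P" by (auto simp: P_def)
    moreover have "y = (z i + q) + (w - z i)" using qw by simp
    ultimately show ?thesis using integer_points_diff[OF qw(2) z] by blast
  qed
  moreover have "p = q" if "p \<in> P" "q \<in> P" "p - q \<in> integer_points" for p q
    using that inj unfolding P_def by blast
  ultimately show thesis using that PA P_meas by blast
qed

section \<open>The two inequalities, for an arbitrary covering factor\<close>

lemma measure_scaleR_image:
  fixes S :: "(real ^ 'n) set"
  shows "measure lebesgue ((*\<^sub>R) c ` S) = \<bar>c\<bar> ^ CARD('n) * measure lebesgue S"
  using measure_lebesgue_affine[of c 0 S] by simp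

lemma convex_body_lmeasurable: "K \<in> convex_bodies \<Longrightarrow> K \<in> lmeasurable"
  by (simp add: convex_bodies_def lmeasurable_compact)

lemma lattice_count_le:
  fixes K :: "(real ^ 'n) set"
  assumes K: "K \<in> convex_bodies"
    and m: "0 < m" and cov: "(*\<^sub>R) m ` K + integer_points = UNIV"
  shows "real (lattice_count K) \<le> measure lebesgue K * (1 + m) ^ CARD('n)"
proof -
  have comp: "compact K" and conv: "convex K"
    using K by (auto simp: convex_bodies_def)
  have scaled: "(*\<^sub>R) c ` K \<in> lmeasurable" for c
    by (intro lmeasurable_compact compact_scaling comp)
  obtain P where P: "P \<subseteq> (*\<^sub>R) m ` K" "P \<in> lmeasurable" "measure lebesgue P = 1"
    "P + integer_points = UNIV"
    "\<forall>p\<in>P. \<forall>q\<in>P. p - q \<in> integer_points \<longrightarrow> p = q"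
    by (rule fundamental_domain_exists[OF scaled cov])
  define S where "S = K \<inter> integer_points"
  have fin: "finite S"
    unfolding S_def by (intro finite_integer_points_bounded compact_imp_bounded comp)
  have meas: "(+) s ` P \<in> lmeasurable" for s by (intro measurable_translation P)
  \<comment> \<open>Every tile \<open>s + P\<close> has volume 1, so counting lattice points is
    summing volumes.\<close>
  have "real (lattice_count K) = (\<Sum>s\<in>S. measure lebesgue ((+) s ` P))"
    by (simp add: measure_translation P lattice_count_def S_def)
  also have "\<dots> = measure lebesgue (\<Union>s\<in>S. (+) s ` P)"
  proof (rule measure_UNION'[symmetric])
    show "pairwise (\<lambda>i j. disjnt ((+) i ` P) ((+) j ` P)) S"
    proof (clarsimp simp: pairwise_def disjnt_iff)
      fix s t p q
      assume st: "s \<in> S" "t \<in> S" "s \<noteq> t" "p \<in> P" "q \<in> P" "s + p = t + q"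
      then have "p - q = t - s" by (simp add: algebra_simps)
      then have "p = q" using P(5) st integer_points_diff by (metis S_def IntD2)
      then show False using st by simp
    qed
  qed (use fin meas in auto)
  also have "\<dots> \<le> measure lebesgue ((*\<^sub>R) (1 + m) ` K)"
  proof (rule measure_mono_fmeasurable)
    show "(\<Union>s\<in>S. (+) s ` P) \<subseteq> (*\<^sub>R) (1 + m) ` K"
    proof clarsimp
      fix s p assume s: "s \<in> S" and "p \<in> P"
      then obtain k where k: "k \<in> K" "p = m *\<^sub>R k" using P(1) by blast
      \<comment> \<open>Dividing \<open>s + m k\<close> by \<open>1 + m\<close> leaves a convex
        combination of \<open>s\<close> and \<open>k\<close>.\<close>
      have "(1 / (1 + m)) *\<^sub>R s + (m / (1 + m)) *\<^sub>R k \<in> K"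
        using s k m by (intro convexD[OF conv]) (auto simp: S_def field_simps)
      moreover have "s + p = (1 + m) *\<^sub>R ((1 / (1 + m)) *\<^sub>R s + (m / (1 + m)) *\<^sub>R k)"
        using m k by (simp add: scaleR_right_distrib)
      ultimately show "s + p \<in> (*\<^sub>R) (1 + m) ` K" by blast
    qed
    show "(\<Union>s\<in>S. (+) s ` P) \<in> sets lebesgue"
      using fin meas by (intro sets.finite_UN) (auto intro: fmeasurableD)
  qed (rule scaled)
  also have "\<dots> = measure lebesgue K * (1 + m) ^ CARD('n)"
    using m by (simp add: measure_scaleR_image)
  finally show ?thesis .
qed

lemma lattice_count_interior_ge:
  fixes K :: "(real ^ 'n) set"
  assumes K: "K \<in> convex_bodies"
    and m: "0 < m" "m \<le> 1" and cov: "(*\<^sub>R) m ` K + integer_points = UNIV"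
  shows "measure lebesgue K * (1 - m) ^ CARD('n) \<le> real (lattice_count (interior K))"
proof (cases "m = 1")
  case True
  \<comment> \<open>Here the left side is zero since the dimension is positive. The case is split
    off because shrinking towards the interior and openness of the scaled interior below require
    \<open>1 - m\<close> to be nonzero.\<close>
  then show ?thesis by (simp add: zero_power)
next
  case False
  then have m1: "m < 1" using m by simp
  have comp: "compact K" and conv: "convex K"
    using K by (auto simp: convex_bodies_def)
  have scaled: "(*\<^sub>R) c ` K \<in> lmeasurable" for c
    by (intro lmeasurable_compact compact_scaling comp)
  \<comment> \<open>The lattice is symmetric, so covering \<open>- y\<close> by \<open>m K\<close>
    covers \<open>y\<close> by \<open>- m K\<close>.\<close>
  have "y \<in> (*\<^sub>R) (- m) ` K + integer_points" for y
  proof -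
    obtain k z where "k \<in> K" "z \<in> integer_points" "- y = m *\<^sub>R k + z"
      by (rule covering_decomposition[OF cov])
    then have "y = (- m) *\<^sub>R k + - z" by (simp add: minus_equation_iff[of y] algebra_simps)
    then show ?thesis using \<open>k \<in> K\<close> integer_points_minus[OF \<open>z \<in> integer_points\<close>] by blast
  qed
  then have cov': "(*\<^sub>R) (- m) ` K + integer_points = UNIV" by blast
  obtain P where P: "P \<subseteq> (*\<^sub>R) (- m) ` K" "P \<in> lmeasurable" "measure lebesgue P = 1"
    "P + integer_points = UNIV"
    "\<forall>p\<in>P. \<forall>q\<in>P. p - q \<in> integer_points \<longrightarrow> p = q"
    by (rule fundamental_domain_exists[OF scaled cov'])
  define S where "S = interior K \<inter> integer_points"
  have fin: "finite S"
    unfolding S_def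
    by (intro finite_integer_points_bounded bounded_interior compact_imp_bounded comp)
  have meas: "(+) s ` P \<in> lmeasurable" for s by (intro measurable_translation P)
  \<comment> \<open>Passing to the interior keeps the volume, the frontier of a convex set being
    negligible.\<close>
  have "measure lebesgue K * (1 - m) ^ CARD('n) = measure lebesgue ((*\<^sub>R) (1 - m) ` interior K)"
    unfolding measure_scaleR_image
      measure_interior[OF compact_imp_bounded[OF comp] negligible_convex_frontier[OF conv]]
    using m by simp
  also have "\<dots> \<le> measure lebesgue (\<Union>s\<in>S. (+) s ` P)"
  proof (rule measure_mono_fmeasurable)
    show "(*\<^sub>R) (1 - m) ` interior K \<subseteq> (\<Union>s\<in>S. (+) s ` P)"
    proof clarsimp
      fix x assume x: "x \<in> interior K"
      obtain p s where ps: "p \<in> P" "s \<in> integer_points" "(1 - m) *\<^sub>R x = p + s"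
        using P(4) UNIV_I[of "(1 - m) *\<^sub>R x"] by (metis set_plus_elim)
      obtain k where k: "k \<in> K" "p = (- m) *\<^sub>R k" using P(1) ps by blast
      \<comment> \<open>This point is \<open>(1 - m) x + m k\<close>: the point \<open>k\<close> of
        \<open>K\<close> moved towards the interior point \<open>x\<close> by the positive fraction
        \<open>1 - m\<close>.\<close>
      have "k - (1 - m) *\<^sub>R (k - x) \<in> interior K"
        using m m1 by (intro mem_interior_convex_shrink[OF conv x k(1)]) auto
      moreover have "s = k - (1 - m) *\<^sub>R (k - x)"
        using ps k by (simp add: algebra_simps)
      ultimately have "s \<in> S" using ps by (simp add: S_def)
      then show "\<exists>s\<in>S. (1 - m) *\<^sub>R x \<in> (+) s ` P"
        using ps(1,3) by (metis add.commute image_eqI)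
    qed
    show "(*\<^sub>R) (1 - m) ` interior K \<in> sets lebesgue"
      using m1 by (intro lmeasurable_open[THEN fmeasurableD] open_scaling open_interior
          bounded_scaling bounded_interior compact_imp_bounded comp) auto
    show "(\<Union>s\<in>S. (+) s ` P) \<in> lmeasurable"
      using fin meas by (intro fmeasurable.finite_UN) auto
  qed
  also have "\<dots> \<le> (\<Sum>s\<in>S. measure lebesgue ((+) s ` P))"
    using fin meas by (intro measure_UNION_le) (auto intro: fmeasurableD)
  also have "\<dots> = real (lattice_count (interior K))"
    by (simp add: measure_translation P lattice_count_def S_def)
  finally show ?thesis .
qed

section \<open>Covering radius at most one\<close>

text \<open>For a radius \<open>m\<close> at most 1 and \<open>c\<close> in \<open>K\<close>,
  convexity puts the translate \<open>(1 - m) c + m K\<close> inside \<open>K\<close>, and a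
  translate of a covering set still covers. The converse is minimality of the radius, applied to the
  factor 1.\<close>

lemma covering_radius_le_1_iff:
  fixes K :: "(real ^ 'n) set"
  assumes K: "K \<in> convex_bodies"
  shows "covering_radius K \<le> 1 \<longleftrightarrow> K + integer_points = UNIV"
proof
  assume "K + integer_points = UNIV"
  then show "covering_radius K \<le> 1"
    using covering_radius_least(3)[OF K, of 1] by simp
next
  let ?m = "covering_radius K"
  assume m: "?m \<le> 1"
  note cr = covering_radius_least(1,2)[OF K]
  have "interior K \<noteq> {}" using K by (simp add: convex_bodies_def)
  then have "K \<noteq> {}" by auto
  then obtain c where c: "c \<in> K" by auto
  have "y \<in> K + integer_points" for y
  proof -
    obtain k z where kz: "k \<in> K" "z \<in> integer_points" "y - (1 - ?m) *\<^sub>R c = ?m *\<^sub>R k + z"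
      by (rule covering_decomposition[OF cr(2)])
    have "(1 - ?m) *\<^sub>R c + ?m *\<^sub>R k \<in> K"
      using K c kz cr(1) m by (intro convexD) (auto simp: convex_bodies_def)
    moreover have "y = ((1 - ?m) *\<^sub>R c + ?m *\<^sub>R k) + z"
      using kz(3) by (simp add: algebra_simps)
    ultimately show ?thesis using kz(2) by blast
  qed
  then show "K + integer_points = UNIV" by blast
qed

section \<open>Equality for the unit cube\<close>

lemma unit_cube_convex_body: "(cbox 0 1 :: (real ^ 'n) set) \<in> convex_bodies"
proof -
  have "(\<chi> i. 1 / 2) \<in> (box 0 1 :: (real ^ 'n) set)"
    by (simp add: mem_box_cart)
  then show ?thesis
    by (auto simp: convex_bodies_def)
qed

text \<open>The half-open cube already covers, so the radius is at most 1. A cube of side less than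
  1 leaves a gap between neighbouring translates in each coordinate direction.\<close>

lemma covering_radius_unit_cube: "covering_radius (cbox 0 1 :: (real ^ 'n) set) = 1"
proof (rule antisym)
  let ?I = "cbox 0 1 :: (real ^ 'n) set" and ?m = "covering_radius (cbox 0 1 :: (real ^ 'n) set)"
  have "y \<in> ?I + integer_points" for y
  proof -
    obtain q z where "q \<in> half_open_cube" "z \<in> integer_points" "y = q + z"
      by (rule half_open_cube_cover)
    moreover from this have "q \<in> ?I"
      by (auto simp: half_open_cube_def mem_box_cart less_imp_le)
    ultimately show ?thesis by blast
  qed
  then show "?m \<le> 1"
    using covering_radius_le_1_iff[OF unit_cube_convex_body] by blast
  note cr = covering_radius_least(1,2)[OF unit_cube_convex_body[where 'n = 'n]]
  show "1 \<le> ?m"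
  proof (rule ccontr)
    assume lt: "\<not> 1 \<le> ?m"
    \<comment> \<open>Each coordinate is the midpoint of the gap between \<open>?m\<close> and 1,
      that is, between the intervals from 0 to \<open>?m\<close> and from 1 to
      \<open>1 + ?m\<close>.\<close>
    define y :: "real ^ 'n" where "y = (\<chi> i. (1 + ?m) / 2)"
    obtain k z where kz: "k \<in> ?I" "z \<in> integer_points" "y = ?m *\<^sub>R k + z"
      by (rule covering_decomposition[OF cr(2)])
    \<comment> \<open>One coordinate suffices, and one exists because types are nonempty.\<close>
    fix i :: 'n
    obtain j where j: "z $ i = of_int j"
      using kz(2) by (auto simp: integer_points_def elim: Ints_cases)
    have "0 \<le> k $ i" "k $ i \<le> 1" using kz(1) by (auto simp: mem_box_cart)
    then have "0 \<le> ?m * k $ i" "?m * k $ i \<le> ?m" using cr(1) by (simp_all add: mult_left_le)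
    moreover have "(1 + ?m) / 2 = ?m * k $ i + of_int j"
      using arg_cong[OF kz(3), of "\<lambda>v. v $ i"] j by (simp add: y_def)
    ultimately have "1 - ?m \<le> 2 * real_of_int j" "2 * real_of_int j \<le> 1 + ?m"
      by (simp_all add: field_simps)
    then have "0 < j" "j < 1" using lt by linarith+
    then show False by simp
  qed
qed

text \<open>The lattice points of the closed cube are its vertices, the indicator vectors of the
  subsets of the index type.\<close>

lemma lattice_count_unit_cube: "lattice_count (cbox 0 1 :: (real ^ 'n) set) = 2 ^ CARD('n)"
proof -
  let ?f = "\<lambda>S :: 'n set. (\<chi> i. if i \<in> S then 1 else 0) :: real ^ 'n"
  have "cbox 0 1 \<inter> integer_points = range ?f"
  proof (intro equalityI subsetI)
    fix x :: "real ^ 'n" assume x: "x \<in> cbox 0 1 \<inter> integer_points"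
    have "x $ i = 0 \<or> x $ i = 1" for i
    proof -
      obtain j where "x $ i = of_int j"
        using x by (auto simp: integer_points_def elim: Ints_cases)
      moreover have "0 \<le> x $ i" "x $ i \<le> 1" using x by (auto simp: mem_box_cart)
      ultimately show ?thesis by (simp, linarith)
    qed
    then have "x = ?f {i. x $ i = 1}" by (auto simp: vec_eq_iff)
    then show "x \<in> range ?f" by blast
  qed (auto simp: mem_box_cart integer_points_def)
  moreover have "inj ?f"
    by (auto simp: inj_def vec_eq_iff split: if_splits)
  ultimately have "lattice_count (cbox 0 1 :: (real ^ 'n) set) = card (Pow (UNIV :: 'n set))"
    by (simp add: lattice_count_def card_image)
  then show ?thesis by (simp only: card_Pow finite)
qed

lemma lattice_count_interior_unit_cube:
  "lattice_count (interior (cbox 0 1 :: (real ^ 'n) set)) = 0"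
proof -
  have "x \<notin> integer_points" if "x \<in> box 0 1" for x :: "real ^ 'n"
  proof
    fix i :: 'n
    assume "x \<in> integer_points"
    then obtain j where "x $ i = of_int j"
      by (auto simp: integer_points_def elim: Ints_cases)
    moreover have "0 < x $ i" "x $ i < 1" using that by (auto simp: mem_box_cart)
    ultimately show False by simp
  qed
  then have "interior (cbox 0 1) \<inter> integer_points = ({} :: (real ^ 'n) set)" by auto
  then show ?thesis by (simp add: lattice_count_def)
qed

theorem proposition1p6:
  "(\<forall>K \<in> (convex_bodies :: (real ^ 'n) set set).
      real (lattice_count K) \<le> measure lebesgue K * (1 + covering_radius K) ^ CARD('n)
    \<and> (covering_radius K \<le> 1 \<longleftrightarrow> K + integer_points = UNIV)
    \<and> (covering_radius K \<le> 1 \<longrightarrow>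
         real (lattice_count (interior K)) \<ge> measure lebesgue K * (1 - covering_radius K) ^ CARD('n)))
  \<and> (\<exists>K \<in> (convex_bodies :: (real ^ 'n) set set).
      real (lattice_count K) = measure lebesgue K * (1 + covering_radius K) ^ CARD('n))
  \<and> (\<exists>K \<in> (convex_bodies :: (real ^ 'n) set set).
      covering_radius K \<le> 1
    \<and> real (lattice_count (interior K)) = measure lebesgue K * (1 - covering_radius K) ^ CARD('n))"
proof (intro conjI ballI impI)
  fix K :: "(real ^ 'n) set" assume K: "K \<in> convex_bodies"
  show "real (lattice_count K) \<le> measure lebesgue K * (1 + covering_radius K) ^ CARD('n)"
    using lattice_count_le[OF K covering_radius_least(1,2)[OF K]] .
  show "covering_radius K \<le> 1 \<longleftrightarrow> K + integer_points = UNIV"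
    by (rule covering_radius_le_1_iff[OF K])
  assume "covering_radius K \<le> 1"
  then show "real (lattice_count (interior K)) \<ge>
      measure lebesgue K * (1 - covering_radius K) ^ CARD('n)"
    using lattice_count_interior_ge[OF K] covering_radius_least(1,2)[OF K] by blast
next
  show "\<exists>K \<in> (convex_bodies :: (real ^ 'n) set set).
      real (lattice_count K) = measure lebesgue K * (1 + covering_radius K) ^ CARD('n)"
    by (rule bexI[OF _ unit_cube_convex_body])
      (simp add: lattice_count_unit_cube covering_radius_unit_cube measure_unit_cube)
  show "\<exists>K \<in> (convex_bodies :: (real ^ 'n) set set).
      covering_radius K \<le> 1
    \<and> real (lattice_count (interior K)) = measure lebesgue K * (1 - covering_radius K) ^ CARD('n)"
    \<comment> \<open>Both sides vanish: the open cube contains no lattice point, and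
      \<open>1 - covering_radius K\<close> is zero with a positive exponent.\<close>
    using lattice_count_interior_unit_cube[where 'n = 'n]
    by (intro bexI[OF _ unit_cube_convex_body]) (simp add: covering_radius_unit_cube)
qed

end
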